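(* Let $\mathbf{C}$ be the reflexive $4$-cycle: universe $C=\{0,1,2,3\}$ and one binary relation $E^{\mathbf{C}}=C^2\setminus\{(0,2),(2,0),(1,3),(3,1)\}$. Let $D=\{0,1,3\}$, and for $a,b,c\in C$ write $[abc]$ for the map $f: D\to C$ with $(f(0),f(1),f(3))=(a,b,c)$. For $b\in C$ let $\bar b$ denote the map $D^0\to C$ sending the empty tuple to $b$. Let $F$ be the encoding $\{\bar0,\bar1,\bar2,\bar3,[013],[010],[323],[313],[112],[003],[113]\}$. Then $\mathbf{C}$ is $F$-stable.
   Context: A $\wedge$-formula is a conjunction of atoms $R(v_1,\dots,v_k)$ and variable equalities with the usual satisfaction over a structure. For a finite set $S$, a set of maps $S\to C$ is $\wedge$-definable over $\mathbf{C}$ if it is the set of satisfying assignments $S\to C$ of a $\wedge$-formula with variables from $S$; $\langle T\rangle_{\mathbf{C}}$ is the smallest $\wedge$-definable set of maps containing $T$. An automorphism is a bijection of $C$ preserving $E^{\mathbf{C}}$ in both directions. A set $T$ of maps $I\to C$ is surjectively closed over $\mathbf{C}$ if every surjective map in $\langle T\rangle_{\mathbf{C}}$ equals $\gamma\circ t$ for an automorphism $\gamma$ and $t\in T$. For an encoding $F$ (finite set of maps $D^k\to C$, $k\ge 0$ the arity, $D^0=\{\text{empty tuple}\}$) and a finite set $V$: $G_{V,D}$ = all maps $V\to D$; a $(V,F)$-application is a pair $(\bar v,f)$, $f\in F$, $\bar v$ a tuple over $V$ of length the arity of $f$; $A_{V,F}$ the set of them; for $g\in G_{V,D}$ and $\alpha=((v_1,\dots,v_k),f)$,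 $\alpha[g]=f(g(v_1),\dots,g(v_k))$; $t[g]:A_{V,F}\to C$, $\alpha\mapsto\alpha[g]$; $T_V=\{t[g]\mid g\in G_{V,D}\}$. The structure is $F$-stable if for every non-empty finite $V$, every map in $T_V$ is surjective and $T_V$ is surjectively closed. *)

theory Defs
  imports Main "HOL-Library.FuncSet"
begin

record ('r, 'c) rel_struct =
  univ :: "'c set"
  arity :: "'r \<Rightarrow> nat"
  interp :: "'r \<Rightarrow> 'c list set"

definition tuples :: "'a set \<Rightarrow> nat \<Rightarrow> 'a list set" where
  "tuples A k = {xs. length xs = k \<and> set xs \<subseteq> A}"

(* A conjunction is the list of its conjuncts; the empty list is the true formula. *)
datatype ('r, 'v) conjunct = Atom 'r "'v list" | Equal 'v 'v

fun conjunct_over :: "('r, 'c) rel_struct \<Rightarrow> 'v set \<Rightarrow> ('r, 'v) conjunct \<Rightarrow> bool" where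
  "conjunct_over C S (Atom r vs) \<longleftrightarrow> vs \<in> tuples S (arity C r)"
| "conjunct_over C S (Equal u v) \<longleftrightarrow> u \<in> S \<and> v \<in> S"

fun sat_conjunct :: "('r, 'c) rel_struct \<Rightarrow> ('v \<Rightarrow> 'c) \<Rightarrow> ('r, 'v) conjunct \<Rightarrow> bool" where
  "sat_conjunct C h (Atom r vs) \<longleftrightarrow> map h vs \<in> interp C r"
| "sat_conjunct C h (Equal u v) \<longleftrightarrow> h u = h v"

(* A map from S to the universe is represented throughout by an extensional function. *)
definition wedge_definable ::
  "('r, 'c) rel_struct \<Rightarrow> 'v set \<Rightarrow> ('v \<Rightarrow> 'c) set \<Rightarrow> bool" where
  "wedge_definable C S X \<longleftrightarrow>
     (\<exists>\<phi>. (\<forall>a\<in>set \<phi>. conjunct_over C S a) \<and>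
          X = {h \<in> S \<rightarrow>\<^sub>E univ C. \<forall>a\<in>set \<phi>. sat_conjunct C h a})"

(* The least element exists in the situations of interest: see wedge_closure_least. *)
definition wedge_closure ::
  "('r, 'c) rel_struct \<Rightarrow> 'v set \<Rightarrow> ('v \<Rightarrow> 'c) set \<Rightarrow> ('v \<Rightarrow> 'c) set" where
  "wedge_closure C S T = (LEAST X. wedge_definable C S X \<and> T \<subseteq> X)"

definition automorphism :: "('r, 'c) rel_struct \<Rightarrow> ('c \<Rightarrow> 'c) \<Rightarrow> bool" where
  "automorphism C \<gamma> \<longleftrightarrow> bij_betw \<gamma> (univ C) (univ C) \<and>
     (\<forall>r. \<forall>xs \<in> tuples (univ C) (arity C r). xs \<in> interp C r \<longleftrightarrow> map \<gamma> xs \<in> interp C r)"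

definition surjectively_closed ::
  "('r, 'c) rel_struct \<Rightarrow> 'i set \<Rightarrow> ('i \<Rightarrow> 'c) set \<Rightarrow> bool" where
  "surjectively_closed C I T \<longleftrightarrow>
     (\<forall>s \<in> wedge_closure C I T. s ` I = univ C \<longrightarrow>
        (\<exists>\<gamma> t. automorphism C \<gamma> \<and> t \<in> T \<and> s = compose I \<gamma> t))"

(* An encoding consists of pairs (k, f) with f a map from D^k to the universe. *)
type_synonym ('d, 'c) enc_map = "nat \<times> ('d list \<Rightarrow> 'c)"

definition encoding :: "('r, 'c) rel_struct \<Rightarrow> 'd set \<Rightarrow> ('d, 'c) enc_map set \<Rightarrow> bool" where
  "encoding C D F \<longleftrightarrow> finite F \<and> (\<forall>(k, f) \<in> F. f \<in> tuples D k \<rightarrow>\<^sub>E univ C)"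

definition applications ::
  "'v set \<Rightarrow> ('d, 'c) enc_map set \<Rightarrow> ('v list \<times> ('d, 'c) enc_map) set" where
  "applications V F = {(vs, (k, f)) | vs k f. (k, f) \<in> F \<and> vs \<in> tuples V k}"

fun app_value :: "('v \<Rightarrow> 'd) \<Rightarrow> ('v list \<times> ('d, 'c) enc_map) \<Rightarrow> 'c" where
  "app_value g (vs, (k, f)) = f (map g vs)"

definition app_map ::
  "'v set \<Rightarrow> ('d, 'c) enc_map set \<Rightarrow> ('v \<Rightarrow> 'd) \<Rightarrow> ('v list \<times> ('d, 'c) enc_map) \<Rightarrow> 'c" where
  "app_map V F g = restrict (app_value g) (applications V F)"

definition app_maps ::
  "'v set \<Rightarrow> 'd set \<Rightarrow> ('d, 'c) enc_map set \<Rightarrow> (('v list \<times> ('d, 'c) enc_map) \<Rightarrow> 'c) set" where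
  "app_maps V D F = app_map V F ` (V \<rightarrow>\<^sub>E D)"

(* The type argument says where the elements of V come from; stating stability for
   an arbitrary type 'v covers every non-empty finite set V. *)
definition F_stable ::
  "'v itself \<Rightarrow> ('r, 'c) rel_struct \<Rightarrow> 'd set \<Rightarrow> ('d, 'c) enc_map set \<Rightarrow> bool" where
  "F_stable _ C D F \<longleftrightarrow>
     (\<forall>V :: 'v set. finite V \<and> V \<noteq> {} \<longrightarrow>
        (\<forall>t \<in> app_maps V D F. t ` applications V F = univ C) \<and>
        surjectively_closed C (applications V F) (app_maps V D F))"

datatype edge_symbol = Edge

definition reflexive_C4 :: "(edge_symbol, nat) rel_struct" where
  "reflexive_C4 =
     \<lparr> univ = {0, 1, 2, 3},
       arity = (\<lambda>_. 2),
       interp = (\<lambda>_. tuples {0, 1, 2, 3} 2 - {[0, 2], [2, 0], [1, 3], [3, 1]}) \<rparr>"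

definition C4_D :: "nat set" where
  "C4_D = {0, 1, 3}"

definition const_map :: "nat \<Rightarrow> (nat, nat) enc_map" where
  "const_map b = (0, (\<lambda>_. undefined)([] := b))"

definition bracket_map :: "nat \<Rightarrow> nat \<Rightarrow> nat \<Rightarrow> (nat, nat) enc_map" where
  "bracket_map a b c = (1, (\<lambda>_. undefined)([0] := a, [1] := b, [3] := c))"

definition C4_F :: "(nat, nat) enc_map set" where
  "C4_F =
     {const_map 0, const_map 1, const_map 2, const_map 3,
      bracket_map 0 1 3, bracket_map 0 1 0, bracket_map 3 2 3, bracket_map 3 1 3,
      bracket_map 1 1 2, bracket_map 0 0 3, bracket_map 1 1 3}"

lemma tuples_0: "tuples A 0 = {[]}"
  by (auto simp: tuples_def)

lemma tuples_1: "tuples A 1 = (\<lambda>x. [x]) ` A"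
  by (auto simp: tuples_def length_Suc_conv)

lemma encoding_C4: "encoding reflexive_C4 C4_D C4_F"
proof -
  have c: "snd (const_map b) \<in> tuples C4_D (fst (const_map b)) \<rightarrow>\<^sub>E univ reflexive_C4"
    if "b \<in> {0, 1, 2, 3}" for b
    using that by (simp add: const_map_def tuples_0 reflexive_C4_def PiE_iff extensional_def)
  have d: "snd (bracket_map a b c) \<in> tuples C4_D (fst (bracket_map a b c)) \<rightarrow>\<^sub>E univ reflexive_C4"
    if "a \<in> {0, 1, 2, 3}" "b \<in> {0, 1, 2, 3}" "c \<in> {0, 1, 2, 3}" for a b c
    using that unfolding bracket_map_def fst_conv snd_conv tuples_1
    by (simp add: C4_D_def reflexive_C4_def PiE_iff extensional_def)
  have "\<forall>p \<in> C4_F. snd p \<in> tuples C4_D (fst p) \<rightarrow>\<^sub>E univ reflexive_C4"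
    unfolding C4_F_def ball_simps by (intro conjI c d TrueI) simp_all
  then show ?thesis
    by (auto simp: encoding_def C4_F_def)
qed

lemma wedge_definable_Int:
  assumes "wedge_definable C S X" "wedge_definable C S Y"
  shows "wedge_definable C S (X \<inter> Y)"
proof -
  obtain \<phi> \<psi> where
    "\<forall>a\<in>set \<phi>. conjunct_over C S a" "X = {h \<in> S \<rightarrow>\<^sub>E univ C. \<forall>a\<in>set \<phi>. sat_conjunct C h a}"
    "\<forall>a\<in>set \<psi>. conjunct_over C S a" "Y = {h \<in> S \<rightarrow>\<^sub>E univ C. \<forall>a\<in>set \<psi>. sat_conjunct C h a}"
    using assms unfolding wedge_definable_def by blast
  then have "(\<forall>a\<in>set (\<phi> @ \<psi>). conjunct_over C S a) \<and>
      X \<inter> Y = {h \<in> S \<rightarrow>\<^sub>E univ C. \<forall>a\<in>set (\<phi> @ \<psi>). sat_conjunct C h a}"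
    by auto
  then show ?thesis
    unfolding wedge_definable_def by blast
qed

lemma wedge_definable_maps: "wedge_definable C S (S \<rightarrow>\<^sub>E univ C)"
  unfolding wedge_definable_def by (rule exI[of _ "[]"]) simp

lemma wedge_closure_least:
  assumes "finite S" "finite (univ C)" "T \<subseteq> S \<rightarrow>\<^sub>E univ C"
  shows "wedge_definable C S (wedge_closure C S T)"
    and "T \<subseteq> wedge_closure C S T"
    and "\<And>X. wedge_definable C S X \<Longrightarrow> T \<subseteq> X \<Longrightarrow> wedge_closure C S T \<subseteq> X"
proof -
  let ?P = "\<lambda>X. wedge_definable C S X \<and> T \<subseteq> X"
  let ?M = "{X. ?P X}"
  have "X \<subseteq> S \<rightarrow>\<^sub>E univ C" if "?P X" for X
    using that unfolding wedge_definable_def by auto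
  then have "?M \<subseteq> Pow (S \<rightarrow>\<^sub>E univ C)"
    by blast
  moreover have "finite (S \<rightarrow>\<^sub>E univ C)"
    using assms by (simp add: finite_PiE)
  ultimately have fin: "finite ?M"
    by (meson finite_Pow_iff finite_subset)
  have ne: "?M \<noteq> {}"
    using assms(3) wedge_definable_maps by blast
  have "?P (\<Inter>N)" if "finite N" "N \<noteq> {}" "N \<subseteq> ?M" for N
    using that by (induction N rule: finite_ne_induct) (auto intro: wedge_definable_Int)
  then have P: "?P (\<Inter>?M)"
    using fin ne by blast
  have eq: "wedge_closure C S T = \<Inter>?M"
    unfolding wedge_closure_def by (rule Least_equality) (use P in auto)
  show "wedge_definable C S (wedge_closure C S T)" "T \<subseteq> wedge_closure C S T"
    using P eq by auto
  show "\<And>X. wedge_definable C S X \<Longrightarrow> T \<subseteq> X \<Longrightarrow> wedge_closure C S T \<subseteq> X"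
    using eq by auto
qed

end

theory Submission
  imports Defs
begin

text \<open>
  A map in \<open>\<langle>T\<^sub>V\<rangle>\<close> preserves every edge between applications that all the maps \<open>t[g]\<close> satisfy.
  The applications thus form a graph: four constants in a cycle and, for each \<open>v \<in> V\<close>, a column of
  seven vertices. If the constants are mapped bijectively, then they are mapped by an automorphism
  \<open>\<gamma>\<close>, and the edges force each column to be \<open>\<gamma> \<circ> t[g]\<close> for some value \<open>g(v) \<in> D\<close>. Otherwise,
  the constants miss some value of \<open>C\<close>. They are not all equal, for a column is unable to attain the
  value opposite to all constants; so they miss at most two values, which a surjective map has to
  attain in at most two columns, and a finite case analysis rules this out.
\<close>

section \<open>Applications and the closure over a general structure\<close>

lemma finite_tuples:
  assumes "finite A"
  shows "finite (tuples A k)"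
proof -
  have "tuples A k = {xs. set xs \<subseteq> A \<and> length xs = k}"
    by (auto simp: tuples_def)
  then show ?thesis
    using finite_lists_length_eq[OF assms] by simp
qed

lemma finite_applications:
  assumes "finite V" "finite F"
  shows "finite (applications V F)"
proof -
  have "applications V F = (\<Union>p\<in>F. (\<lambda>vs. (vs, p)) ` tuples V (fst p))"
    by (auto simp: applications_def)
  then show ?thesis
    using assms by (simp add: finite_tuples)
qed

lemma app_maps_subset:
  assumes "encoding C D F"
  shows "app_maps V D F \<subseteq> applications V F \<rightarrow>\<^sub>E univ C"
proof -
  have "f (map g vs) \<in> univ C" if "g \<in> V \<rightarrow>\<^sub>E D" "(k, f) \<in> F" "vs \<in> tuples V k" for g vs k f
  proof -
    have "map g vs \<in> tuples D k"
      using that by (auto simp: tuples_def)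
    then show ?thesis
      using assms that(2) by (auto simp: encoding_def)
  qed
  then have "app_value g \<alpha> \<in> univ C" if "g \<in> V \<rightarrow>\<^sub>E D" "\<alpha> \<in> applications V F" for g \<alpha>
    using that by (auto simp: applications_def)
  then show ?thesis
    by (auto simp: app_maps_def app_map_def simp flip: restrict_PiE_iff)
qed

lemma wedge_closure_subset:
  assumes "finite S" "finite (univ C)" "T \<subseteq> S \<rightarrow>\<^sub>E univ C"
  shows "wedge_closure C S T \<subseteq> S \<rightarrow>\<^sub>E univ C"
  by (rule wedge_closure_least(3)[OF assms wedge_definable_maps assms(3)])

text \<open>A single atom is already a formula, so its solution set is one of the definable sets
  containing \<open>T\<close> among which the closure is the least.\<close>

lemma wedge_closure_atom:
  assumes "finite S" "finite (univ C)" and T: "T \<subseteq> S \<rightarrow>\<^sub>E univ C"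
    and s: "s \<in> wedge_closure C S T"
    and vs: "vs \<in> tuples S (arity C r)"
    and atom: "\<And>t. t \<in> T \<Longrightarrow> map t vs \<in> interp C r"
  shows "map s vs \<in> interp C r"
proof -
  let ?X = "{h \<in> S \<rightarrow>\<^sub>E univ C. \<forall>a\<in>set [Atom r vs]. sat_conjunct C h a}"
  have "wedge_definable C S ?X"
    unfolding wedge_definable_def using vs by (intro exI[of _ "[Atom r vs]"]) simp
  moreover have "T \<subseteq> ?X"
    using T atom by auto
  ultimately have "wedge_closure C S T \<subseteq> ?X"
    by (rule wedge_closure_least(3)[OF assms(1-3)])
  then show ?thesis
    using s by auto
qed

section \<open>The 4-cycle in terms of two bits\<close>

definition adj :: "nat \<Rightarrow> nat \<Rightarrow> bool" where
  "adj a b \<longleftrightarrow> [a, b] \<in> interp reflexive_C4 Edge"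

text \<open>The 4-cycle as a square: vertices are pairs of bits, and two vertices are adjacent unless both
  bits differ. The finite case analyses thereby become propositional, and complementing the bits
  moves any vertex to any other one.\<close>

definition bit_P :: "nat \<Rightarrow> bool" where
  "bit_P a \<longleftrightarrow> a < 2"

definition bit_Q :: "nat \<Rightarrow> bool" where
  "bit_Q a \<longleftrightarrow> a = 0 \<or> a = 3"

lemma adj_iff: "adj a b \<longleftrightarrow> a < 4 \<and> b < 4 \<and> (bit_P a = bit_P b \<or> bit_Q a = bit_Q b)"
  by (auto simp: adj_def reflexive_C4_def tuples_def bit_P_def bit_Q_def)

lemma bits_eq_iff: "a < 4 \<Longrightarrow> b < 4 \<Longrightarrow> a = b \<longleftrightarrow> bit_P a = bit_P b \<and> bit_Q a = bit_Q b"
  by (auto simp: bit_P_def bit_Q_def)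

lemma bits_surj: "\<exists>a<4. bit_P a = p \<and> bit_Q a = q"
proof -
  have "bit_P 0 \<and> bit_Q 0" "bit_P 1 \<and> \<not> bit_Q 1" "\<not> bit_P 2 \<and> \<not> bit_Q 2" "\<not> bit_P 3 \<and> bit_Q 3"
    by (simp_all add: bit_P_def bit_Q_def)
  then show ?thesis
    by (cases p; cases q) (force simp: numeral_eq_Suc)+
qed

lemma univ_C4: "univ reflexive_C4 = {..<4}"
  by (auto simp: reflexive_C4_def)

section \<open>The edges of columns and their case analysis\<close>

definition triples :: "(nat \<times> nat \<times> nat) set" where
  "triples = {(0, 1, 3), (0, 1, 0), (3, 2, 3), (3, 1, 3), (1, 1, 2), (0, 0, 3), (1, 1, 3)}"

text \<open>A triple \<open>(i, j, k)\<close> stands for the map \<open>[ijk]\<close>, and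
  \<open>coord d\<close> evaluates it at \<open>d\<close>; on \<open>C4_D\<close> the last branch
  means \<open>d = 3\<close>.\<close>

fun coord :: "nat \<Rightarrow> nat \<times> nat \<times> nat \<Rightarrow> nat" where
  "coord d (i, j, k) = (if d = 0 then i else if d = 1 then j else k)"

text \<open>Here \<open>c\<close> stands for the values of the constants and \<open>x\<close> for those of one column; the edges are
  the ones for which the triples are adjacent in each of the three coordinates. For an edge of
  \<open>cross\<close>, between two columns, any coordinate has to be adjacent to any other.\<close>

definition gadget ::
  "('a \<Rightarrow> 'a \<Rightarrow> bool) \<Rightarrow> (nat \<Rightarrow> 'a) \<Rightarrow> (nat \<Rightarrow> nat \<Rightarrow> nat \<Rightarrow> 'a) \<Rightarrow> bool" where
  "gadget E c x \<longleftrightarrow>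
     E (c 0) (c 1) \<and> E (c 1) (c 2) \<and> E (c 2) (c 3) \<and> E (c 3) (c 0) \<and>
     E (x 0 1 3) (c 0) \<and> E (x 0 1 0) (c 0) \<and> E (x 0 1 0) (c 1) \<and>
     E (x 3 2 3) (c 2) \<and> E (x 3 2 3) (c 3) \<and> E (x 3 1 3) (c 0) \<and> E (x 3 1 3) (c 2) \<and>
     E (x 1 1 2) (c 1) \<and> E (x 1 1 2) (c 2) \<and> E (x 0 0 3) (c 0) \<and> E (x 0 0 3) (c 3) \<and>
     E (x 1 1 3) (c 0) \<and> E (x 1 1 3) (c 2) \<and>
     E (x 0 1 3) (x 0 1 0) \<and> E (x 0 1 3) (x 3 2 3) \<and> E (x 0 1 3) (x 3 1 3) \<and>
     E (x 0 1 3) (x 1 1 2) \<and> E (x 0 1 3) (x 0 0 3) \<and> E (x 0 1 3) (x 1 1 3) \<and>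
     E (x 0 1 0) (x 3 2 3) \<and> E (x 0 1 0) (x 3 1 3) \<and> E (x 0 1 0) (x 0 0 3) \<and>
     E (x 0 1 0) (x 1 1 3) \<and> E (x 3 2 3) (x 3 1 3) \<and> E (x 3 1 3) (x 0 0 3) \<and>
     E (x 1 1 2) (x 0 0 3) \<and> E (x 1 1 2) (x 1 1 3) \<and> E (x 0 0 3) (x 1 1 3)"

definition cross :: "('a \<Rightarrow> 'a \<Rightarrow> bool) \<Rightarrow> (nat \<Rightarrow> nat \<Rightarrow> nat \<Rightarrow> 'a) \<Rightarrow> (nat \<Rightarrow> nat \<Rightarrow> nat \<Rightarrow> 'a) \<Rightarrow> bool"
  where "cross E x y \<longleftrightarrow> E (x 0 1 0) (y 0 1 0) \<and> E (x 3 2 3) (y 3 2 3) \<and>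
     E (x 1 1 2) (y 1 1 2) \<and> E (x 0 0 3) (y 0 0 3)"

text \<open>A conjunction of edges survives weakening of the edge relation. This replaces adjacency
  by mere agreement in one of two bits.\<close>

lemma gadget_mono: "gadget E c x \<Longrightarrow> (\<And>a b. E a b \<Longrightarrow> E' a b) \<Longrightarrow> gadget E' c x"
  unfolding gadget_def by blast

lemma cross_mono: "cross E x y \<Longrightarrow> (\<And>a b. E a b \<Longrightarrow> E' a b) \<Longrightarrow> cross E' x y"
  unfolding cross_def by blast

lemma image_lessThan_4: "c ` {..<4::nat} = {c 0, c 1, c 2, c 3}"
  by (auto simp: numeral_eq_Suc lessThan_Suc)

text \<open>These rules expand quantifiers over the four constants and the seven triples into
  propositional form.\<close>

lemmas value_simps = image_lessThan_4 triples_def image_insert image_empty Un_insert_left Un_empty_left bex_simps ball_simps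
  case_prod_conv simp_thms

text \<open>In the application, \<open>P\<close> and \<open>Q\<close> compare the bits of a vertex
  with those of a value \<open>m\<close>, so that \<open>m\<close> is the corner where both hold.
  Column \<open>x\<close> attains \<open>m\<close>, and column \<open>y\<close> attains whichever
  other values the constants miss; both may be the same column. The conclusion is that the constants
  do not miss \<open>m\<close>.\<close>

lemma gadget_two_columns:
  fixes P Q :: "'a \<Rightarrow> bool"
  assumes x: "gadget E c x" and y: "gadget E c y" and xy: "cross E x y"
    and E: "\<And>a b. E a b \<Longrightarrow> P a = P b \<or> Q a = Q b"
    and diff: "\<not> (\<forall>i<4. P (c i) = P (c 0) \<and> Q (c i) = Q (c 0))"
    and TT: "\<exists>z \<in> (\<lambda>(i, j, k). x i j k) ` triples. P z \<and> Q z"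
    and other: "\<And>p q. \<not> (p \<and> q) \<Longrightarrow>
      \<exists>z \<in> c ` {..<4} \<union> (\<lambda>(i, j, k). y i j k) ` triples. P z = p \<and> Q z = q"
  shows "\<exists>z \<in> c ` {..<4}. P z \<and> Q z"
proof (rule ccontr)
  assume none: "\<not> ?thesis"
  define A where "A a b \<longleftrightarrow> P a = P b \<or> Q a = Q b" for a b
  have A: "A a b" if "E a b" for a b
    using E[OF that] by (simp add: A_def)
  have edges: "gadget A c x" "gadget A c y" "cross A x y"
    by (rule gadget_mono[OF x] gadget_mono[OF y] cross_mono[OF xy], erule A)+
  have diff': "\<not> ((P (c 1) = P (c 0) \<and> Q (c 1) = Q (c 0)) \<and>
      (P (c 2) = P (c 0) \<and> Q (c 2) = Q (c 0)) \<and> (P (c 3) = P (c 0) \<and> Q (c 3) = Q (c 0)))"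
    using diff by (auto simp: numeral_eq_Suc less_Suc_eq)
  have other': "\<exists>z \<in> c ` {..<4} \<union> (\<lambda>(i, j, k). y i j k) ` triples. P z \<and> \<not> Q z"
      "\<exists>z \<in> c ` {..<4} \<union> (\<lambda>(i, j, k). y i j k) ` triples. \<not> P z \<and> Q z"
      "\<exists>z \<in> c ` {..<4} \<union> (\<lambda>(i, j, k). y i j k) ` triples. \<not> P z \<and> \<not> Q z"
    using other[of True False] other[of False True] other[of False False] by simp_all
  \<comment> \<open>Two bits for each of the four constants and each of the seven vertices in both
    columns: a finite propositional problem.\<close>
  show False
    using edges[unfolded gadget_def cross_def A_def] diff' none[unfolded value_simps]
      TT[unfolded value_simps] other'[unfolded value_simps]
    by (smt (verit))
qed

text \<open>On \<open>C4_D\<close>, the maps \<open>[010]\<close>, \<open>[323]\<close>,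
  \<open>[313]\<close> only tell whether \<open>d = 1\<close>, and \<open>[112]\<close>,
  \<open>[003]\<close>, \<open>[113]\<close> only whether \<open>d = 3\<close>. The edges force each
  of the two groups to be consistent and exclude that both answers are yes; the vertex
  \<open>[013]\<close> then has a single value left.\<close>

lemma gadget_one_column:
  fixes P Q :: "'a \<Rightarrow> bool"
  assumes x: "gadget E c x"
    and E: "\<And>a b. E a b \<Longrightarrow> P a = P b \<or> Q a = Q b"
    and diff: "\<And>i j. i < 4 \<Longrightarrow> j < 4 \<Longrightarrow> i \<noteq> j \<Longrightarrow> P (c i) \<noteq> P (c j) \<or> Q (c i) \<noteq> Q (c j)"
  shows "\<exists>d \<in> C4_D. \<forall>(i, j, k) \<in> triples. let l = coord d (i, j, k) in P (x i j k) = P (c l) \<and> Q (x i j k) = Q (c l)"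
proof -
  define A where "A a b \<longleftrightarrow> P a = P b \<or> Q a = Q b" for a b
  define B where "B a b \<longleftrightarrow> P a = P b \<and> Q a = Q b" for a b
  have A: "A a b" if "E a b" for a b
    using E[OF that] by (simp add: A_def)
  have "gadget A c x"
    by (rule gadget_mono[OF x]) (rule A)
  note e = this[unfolded gadget_def A_def]
  have d: "\<not> B (c 0) (c 1)" "\<not> B (c 0) (c 2)" "\<not> B (c 0) (c 3)"
      "\<not> B (c 1) (c 2)" "\<not> B (c 1) (c 3)" "\<not> B (c 2) (c 3)"
    using diff by (simp_all add: B_def)
  \<comment> \<open>The edges to the constants leave two values for each vertex; the edges within
    the group leave the combinations for \<open>d \<noteq> 1\<close> and
    \<open>d = 1\<close>.\<close>
  have 1: "(B (x 0 1 0) (c 0) \<and> B (x 3 2 3) (c 3) \<and> B (x 3 1 3) (c 3)) \<or>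
     (B (x 0 1 0) (c 1) \<and> B (x 3 2 3) (c 2) \<and> B (x 3 1 3) (c 1))"
    using e d unfolding B_def by (smt (verit))
  \<comment> \<open>Likewise for \<open>d \<noteq> 3\<close> and \<open>d = 3\<close>.\<close>
  have 2: "(B (x 1 1 2) (c 1) \<and> B (x 0 0 3) (c 0) \<and> B (x 1 1 3) (c 1)) \<or>
     (B (x 1 1 2) (c 2) \<and> B (x 0 0 3) (c 3) \<and> B (x 1 1 3) (c 3))"
    using e d unfolding B_def by (smt (verit))
  \<comment> \<open>The disjuncts belong to \<open>d = 0\<close>, \<open>d = 1\<close> and
    \<open>d = 3\<close>, in this order.\<close>
  have 3: "(B (x 0 1 3) (c 0) \<and> B (x 0 1 0) (c 0) \<and> B (x 1 1 2) (c 1)) \<or>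
     (B (x 0 1 3) (c 1) \<and> B (x 0 1 0) (c 1) \<and> B (x 1 1 2) (c 1)) \<or>
     (B (x 0 1 3) (c 3) \<and> B (x 0 1 0) (c 0) \<and> B (x 1 1 2) (c 2))"
    using e d 1 2 unfolding B_def by (smt (verit))
  \<comment> \<open>The alternatives in \<open>1\<close> and in \<open>2\<close> exclude each other,
    so each disjunct of \<open>3\<close> selects one of each.\<close>
  have no: "\<not> (B (x 0 1 0) (c 0) \<and> B (x 0 1 0) (c 1))"
      "\<not> (B (x 1 1 2) (c 1) \<and> B (x 1 1 2) (c 2))"
    using d by (auto simp: B_def)
  show ?thesis
    unfolding B_def[symmetric] C4_D_def triples_def Let_def using 1 2 3 no
    by simp blast
qed

section \<open>Applications of the encoding, edges in the closure, automorphisms\<close>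

abbreviation const_app :: "nat \<Rightarrow> 'v list \<times> (nat, nat) enc_map" where
  "const_app b \<equiv> ([], const_map b)"

abbreviation bracket_app :: "'v \<Rightarrow> nat \<Rightarrow> nat \<Rightarrow> nat \<Rightarrow> 'v list \<times> (nat, nat) enc_map" where
  "bracket_app v a b c \<equiv> ([v], bracket_map a b c)"

lemma applications_C4:
  "applications V C4_F =
    const_app ` {..<4} \<union> {bracket_app v i j k | v i j k. v \<in> V \<and> (i, j, k) \<in> triples}"
proof -
  have app: "applications V F = (\<Union>p\<in>F. (\<lambda>vs. (vs, p)) ` tuples V (fst p))"
    for F :: "(nat, nat) enc_map set"
    by (auto simp: applications_def)
  have const: "tuples V (fst (const_map b)) = {[]}" for b
    by (simp add: const_map_def tuples_0)
  have bracket: "tuples V (fst (bracket_map a b c)) = (\<lambda>v. [v]) ` V" for a b c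
    unfolding bracket_map_def fst_conv by (rule tuples_1)
  have F: "C4_F = const_map ` {..<4} \<union> (\<lambda>(a, b, c). bracket_map a b c) ` triples"
    unfolding C4_F_def triples_def image_lessThan_4 image_insert image_empty case_prod_conv
      Un_insert_left Un_empty_left by (rule refl)
  have "(\<Union>p\<in>const_map ` {..<4}. (\<lambda>vs. (vs, p)) ` tuples V (fst p)) = const_app ` {..<4}"
    by (auto simp: const)
  moreover have "(\<Union>p\<in>(\<lambda>(a, b, c). bracket_map a b c) ` triples. (\<lambda>vs. (vs, p)) ` tuples V (fst p)) =
      {bracket_app v i j k | v i j k. v \<in> V \<and> (i, j, k) \<in> triples}" (is "?L = ?R")
  proof
    show "?L \<subseteq> ?R"
    proof
      fix \<alpha> assume "\<alpha> \<in> ?L"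
      then obtain t where "t \<in> triples"
        "\<alpha> \<in> (\<lambda>vs. (vs, case t of (a, b, c) \<Rightarrow> bracket_map a b c)) `
          tuples V (fst (case t of (a, b, c) \<Rightarrow> bracket_map a b c))"
        by blast
      then show "\<alpha> \<in> ?R"
        by (cases t) (simp add: bracket, blast)
    qed
    show "?R \<subseteq> ?L"
    proof
      fix \<alpha> assume "\<alpha> \<in> ?R"
      then obtain v i j k where "v \<in> V" "(i, j, k) \<in> triples" "\<alpha> = bracket_app v i j k"
        by blast
      then show "\<alpha> \<in> ?L"
        by (intro UN_I[of "bracket_map i j k"]) (force, simp add: bracket)
    qed
  qed
  ultimately show ?thesis
    unfolding app F UN_Un by (rule arg_cong2[where f = "(\<union>)"])
qed

lemma applications_C4_cases:
  assumes "\<alpha> \<in> applications V C4_F"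
  obtains b where "b < 4" "\<alpha> = const_app b"
    | v i j k where "v \<in> V" "(i, j, k) \<in> triples" "\<alpha> = bracket_app v i j k"
  using assms unfolding applications_C4 by auto

lemma app_value_const_app: "app_value g (const_app b) = b"
  by (simp add: const_map_def)

text \<open>The hypothesis matters: outside \<open>C4_D\<close> the encoding map is
  \<open>undefined\<close>, whereas \<open>coord\<close> takes its last branch.\<close>

lemma app_value_bracket_app:
  "g v \<in> C4_D \<Longrightarrow> app_value g (bracket_app v i j k) = coord (g v) (i, j, k)"
  by (auto simp: bracket_map_def C4_D_def)

text \<open>Apart from the range of \<open>s\<close>, this is all that the main argument uses about
  the closure: an edge common to all \<open>t[g]\<close> is an edge for \<open>s\<close>.\<close>

lemma wedge_closure_adj:
  assumes V: "finite V"
    and s: "s \<in> wedge_closure reflexive_C4 (applications V C4_F) (app_maps V C4_D C4_F)"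
    and \<alpha>: "\<alpha> \<in> applications V C4_F" and \<beta>: "\<beta> \<in> applications V C4_F"
    and adj: "\<And>g. g \<in> V \<rightarrow> C4_D \<Longrightarrow> adj (app_value g \<alpha>) (app_value g \<beta>)"
  shows "adj (s \<alpha>) (s \<beta>)"
proof -
  have "map s [\<alpha>, \<beta>] \<in> interp reflexive_C4 Edge"
  proof (rule wedge_closure_atom)
    show "finite (applications V C4_F)"
      using V encoding_C4 by (simp add: finite_applications encoding_def)
    show "finite (univ reflexive_C4)"
      by (simp add: univ_C4)
    show "app_maps V C4_D C4_F \<subseteq> applications V C4_F \<rightarrow>\<^sub>E univ reflexive_C4"
      by (rule app_maps_subset[OF encoding_C4])
    show "s \<in> wedge_closure reflexive_C4 (applications V C4_F) (app_maps V C4_D C4_F)"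
      by (rule s)
    show "[\<alpha>, \<beta>] \<in> tuples (applications V C4_F) (arity reflexive_C4 Edge)"
      using \<alpha> \<beta> by (simp add: tuples_def reflexive_C4_def)
    fix t assume "t \<in> app_maps V C4_D C4_F"
    then obtain g where "g \<in> V \<rightarrow> C4_D" "t = app_map V C4_F g"
      by (auto simp: app_maps_def PiE_def)
    then show "map t [\<alpha>, \<beta>] \<in> interp reflexive_C4 Edge"
      using adj[of g] \<alpha> \<beta> by (simp add: app_map_def adj_def)
  qed
  then show ?thesis
    by (simp add: adj_def)
qed

text \<open>Two vertices of one column are evaluated at the same \<open>d = g v\<close>, so each
  edge needs a check for three values of \<open>d\<close> only.\<close>

lemma closure_gadget:
  assumes V: "finite V" "v \<in> V"
    and s: "s \<in> wedge_closure reflexive_C4 (applications V C4_F) (app_maps V C4_D C4_F)"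
  shows "gadget adj (\<lambda>b. s (const_app b)) (\<lambda>i j k. s (bracket_app v i j k))"
proof -
  have const: "const_app b \<in> applications V C4_F" if "b < 4" for b
    using that by (auto simp: applications_C4)
  have bracket: "bracket_app v i j k \<in> applications V C4_F" if "(i, j, k) \<in> triples" for i j k
    using that V(2) unfolding applications_C4 by blast
  have cc: "adj (s (const_app a)) (s (const_app b))" if "adj a b" for a b
    by (rule wedge_closure_adj[OF V(1) s const const])
      (use that in \<open>auto simp: app_value_const_app adj_iff simp del: app_value.simps\<close>)
  have bc: "adj (s (bracket_app v i j k)) (s (const_app b))"
    if "(i, j, k) \<in> triples" "b < 4" "\<And>d. d \<in> C4_D \<Longrightarrow> adj (coord d (i, j, k)) b" for i j k b
  proof (rule wedge_closure_adj[OF V(1) s bracket[OF that(1)] const[OF that(2)]])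
    fix g assume "g \<in> V \<rightarrow> C4_D"
    then have "g v \<in> C4_D"
      using V(2) by blast
    then show "adj (app_value g (bracket_app v i j k)) (app_value g (const_app b))"
      unfolding app_value_const_app by (simp only: app_value_bracket_app that(3))
  qed
  have bb: "adj (s (bracket_app v i j k)) (s (bracket_app v i' j' k'))"
    if "(i, j, k) \<in> triples" "(i', j', k') \<in> triples"
      "\<And>d. d \<in> C4_D \<Longrightarrow> adj (coord d (i, j, k)) (coord d (i', j', k'))" for i j k i' j' k'
  proof (rule wedge_closure_adj[OF V(1) s bracket[OF that(1)] bracket[OF that(2)]])
    fix g assume "g \<in> V \<rightarrow> C4_D"
    then have "g v \<in> C4_D"
      using V(2) by blast
    then show "adj (app_value g (bracket_app v i j k)) (app_value g (bracket_app v i' j' k'))"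
      by (simp only: app_value_bracket_app that(3))
  qed
  show ?thesis
    unfolding gadget_def
    by (intro conjI cc bc bb)
      (auto simp: triples_def C4_D_def adj_iff bit_P_def bit_Q_def)
qed

text \<open>The values \<open>g v\<close> and \<open>g w\<close> may be unrelated. The images of
  \<open>[010]\<close>, \<open>[323]\<close>, \<open>[112]\<close> and \<open>[003]\<close> are the
  four edges of the cycle, so any two values of one of these maps are adjacent.\<close>

lemma closure_cross:
  assumes V: "finite V" "v \<in> V" "w \<in> V"
    and s: "s \<in> wedge_closure reflexive_C4 (applications V C4_F) (app_maps V C4_D C4_F)"
  shows "cross adj (\<lambda>i j k. s (bracket_app v i j k)) (\<lambda>i j k. s (bracket_app w i j k))"
proof -
  have bracket: "bracket_app u i j k \<in> applications V C4_F"
    if "(i, j, k) \<in> triples" "u \<in> V" for u i j k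
    using that unfolding applications_C4 by blast
  have bb: "adj (s (bracket_app v i j k)) (s (bracket_app w i j k))"
    if "(i, j, k) \<in> triples"
      "\<And>d e. d \<in> C4_D \<Longrightarrow> e \<in> C4_D \<Longrightarrow> adj (coord d (i, j, k)) (coord e (i, j, k))" for i j k
  proof (rule wedge_closure_adj[OF V(1) s bracket bracket])
    fix g assume "g \<in> V \<rightarrow> C4_D"
    then have "g v \<in> C4_D" "g w \<in> C4_D"
      using V by blast+
    then show "adj (app_value g (bracket_app v i j k)) (app_value g (bracket_app w i j k))"
      by (simp only: app_value_bracket_app that(2))
  qed (use that V in auto)
  show ?thesis
    unfolding cross_def
    by (intro conjI bb) (auto simp: triples_def C4_D_def adj_iff bit_P_def bit_Q_def)
qed

text \<open>If an opposite pair were mapped to an edge, its members would be mapped to vertices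
  adjacent to all four vertices, but every vertex has a non-neighbour. Hence non-edges are preserved
  as well.\<close>

lemma automorphism_C4:
  assumes bij: "bij_betw \<gamma> {..<4} {..<4}"
    and edges: "adj (\<gamma> 0) (\<gamma> 1)" "adj (\<gamma> 1) (\<gamma> 2)" "adj (\<gamma> 2) (\<gamma> 3)" "adj (\<gamma> 3) (\<gamma> 0)"
  shows "automorphism reflexive_C4 \<gamma>"
proof -
  have less: "\<gamma> a < 4" if "a < 4" for a
    using bij that by (auto simp: bij_betw_def)
  have ne: "bit_P (\<gamma> a) \<noteq> bit_P (\<gamma> b) \<or> bit_Q (\<gamma> a) \<noteq> bit_Q (\<gamma> b)" if "a < 4" "b < 4" "a \<noteq> b" for a b
    using bij that bits_eq_iff[OF less less, of a b] by (auto simp: bij_betw_def inj_on_def)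
  have opp: "\<not> adj (\<gamma> 0) (\<gamma> 2)" "\<not> adj (\<gamma> 1) (\<gamma> 3)"
    using edges ne[of 0 1] ne[of 0 2] ne[of 0 3] ne[of 1 2] ne[of 1 3] ne[of 2 3]
    unfolding adj_iff by auto
  have sym: "adj a b \<longleftrightarrow> adj b a" for a b
    by (auto simp: adj_iff)
  have refl: "adj (\<gamma> a) (\<gamma> a)" if "a < 4" for a
    using less[OF that] by (simp add: adj_iff)
  note flip = iffD1[OF sym]
  have gamma: "\<forall>a\<in>{0, 1, 2, 3}. \<forall>b\<in>{0, 1, 2, 3}.
      adj (\<gamma> a) (\<gamma> b) \<longleftrightarrow> \<not> ((a, b) \<in> {(0, 2), (2, 0), (1, 3), (3, 1)})"
    using edges edges[THEN flip] opp opp(1)[unfolded sym[of "\<gamma> 0"]] opp(2)[unfolded sym[of "\<gamma> 1"]]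
      refl[of 0] refl[of 1] refl[of 2] refl[of 3]
    by (simp del: One_nat_def)
  have cycle: "\<forall>a\<in>{0, 1, 2, 3}. \<forall>b\<in>{0, 1, 2, 3}.
      adj a b \<longleftrightarrow> \<not> ((a, b) \<in> {(0, 2), (2, 0), (1, 3), (3, 1)})"
    by (simp add: adj_iff bit_P_def bit_Q_def)
  have adj: "adj a b \<longleftrightarrow> adj (\<gamma> a) (\<gamma> b)" if "a < 4" "b < 4" for a b
  proof -
    have "a \<in> {0, 1, 2, 3}" "b \<in> {0, 1, 2, 3}"
      using that by auto
    then show ?thesis
      by (simp only: gamma[rule_format] cycle[rule_format])
  qed
  have "xs \<in> interp reflexive_C4 r \<longleftrightarrow> map \<gamma> xs \<in> interp reflexive_C4 r"
    if "xs \<in> tuples {..<4} (arity reflexive_C4 r)" for r xs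
  proof -
    have "length xs = 2"
      using that by (simp add: tuples_def reflexive_C4_def)
    then obtain a b where "xs = [a, b]"
      by (auto simp: numeral_2_eq_2 length_Suc_conv)
    then show ?thesis
      using that adj[of a b] unfolding adj_def by (cases r) (simp add: tuples_def)
  qed
  then show ?thesis
    using bij by (simp add: automorphism_def univ_C4)
qed

section \<open>Surjectivity and surjective closure for the reflexive 4-cycle\<close>

theorem theorem3p1:
  shows "F_stable TYPE('v) reflexive_C4 C4_D C4_F"
  unfolding F_stable_def surjectively_closed_def univ_C4
proof (intro allI impI conjI ballI)
  fix V :: "'v set"
  assume "finite V \<and> V \<noteq> {}"
  then have V: "finite V" by simp
  let ?A = "applications V C4_F" and ?T = "app_maps V C4_D C4_F"
  have T: "?T \<subseteq> ?A \<rightarrow>\<^sub>E {..<4}"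
    using app_maps_subset[OF encoding_C4] by (simp add: univ_C4)
  have const: "const_app b \<in> ?A" if "b < 4" for b
    using that by (auto simp: applications_C4)
  {
    fix t assume t: "t \<in> ?T"
    \<comment> \<open>The constants alone attain every value, whatever \<open>g\<close> is.\<close>
    then have "t (const_app b) = b" if "b < 4" for b
      using const[OF that] by (auto simp: app_maps_def app_map_def app_value_const_app simp del: app_value.simps)
    then have "{..<4} \<subseteq> t ` ?A"
      using const by (metis image_eqI lessThan_iff subsetI)
    then show "t ` ?A = {..<4}"
      using T t by auto
  next
    fix s assume s: "s \<in> wedge_closure reflexive_C4 ?A ?T" and surj: "s ` ?A = {..<4}"
    have sA: "s \<in> ?A \<rightarrow>\<^sub>E {..<4}"
      using wedge_closure_subset[of ?A reflexive_C4 ?T] s T V encoding_C4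
      by (auto simp: univ_C4 finite_applications encoding_def)
    define c where "c b = s (const_app b)" for b
    define x where "x v i j k = s (bracket_app v i j k)" for v i j k
    let ?x = "\<lambda>v. (\<lambda>(i, j, k). x v i j k) ` triples"
    have gadget: "gadget adj c (x v)" if "v \<in> V" for v
      using closure_gadget[OF V that s] unfolding c_def x_def .
    have cross: "cross adj (x v) (x w)" if "v \<in> V" "w \<in> V" for v w
      using closure_cross[OF V that s] unfolding x_def .
    have covered: "a \<in> c ` {..<4} \<or> (\<exists>v\<in>V. a \<in> ?x v)" if "a < 4" for a
    proof -
      obtain \<alpha> where "\<alpha> \<in> ?A" "a = s \<alpha>"
        using surj \<open>a < 4\<close> by (metis imageE lessThan_iff)
      then show ?thesis
        by (cases rule: applications_C4_cases[of \<alpha> V]) (force simp: c_def x_def)+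
    qed
    have c_less: "c b < 4" if "b < 4" for b
      using sA const[OF that] by (auto simp: c_def)
    have nonconst: "\<exists>b<4. c b \<noteq> c 0"
    proof (rule ccontr)
      assume "\<not> ?thesis"
      then have c0: "c b = c 0" if "b < 4" for b
        using that by blast
      \<comment> \<open>Flipping both bits gives the vertex opposite to the common value of the
        constants.\<close>
      obtain m where "m < 4" "bit_P m = (\<not> bit_P (c 0))" "bit_Q m = (\<not> bit_Q (c 0))"
        using bits_surj by blast
      then have m: "m < 4" "m \<noteq> c 0" "\<not> adj m (c 0)"
        by (auto simp: adj_iff)
      have "m \<notin> c ` {..<4}"
        using m(2) c0 by blast
      then obtain v where v: "v \<in> V" "m \<in> ?x v"
        using covered[OF m(1)] by blast
      then obtain i j k where "(i, j, k) \<in> triples" "m = x v i j k"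
        by auto
      \<comment> \<open>Each vertex of a column has an edge to the constant 0 or 2, so no column
        attains \<open>m\<close>.\<close>
      moreover have "adj (x v i j k) (c 0) \<or> adj (x v i j k) (c 2)" if "(i, j, k) \<in> triples" for i j k
        using gadget[OF v(1)] that unfolding gadget_def triples_def by auto
      ultimately show False
        using m(3) c0[of 2] by auto
    qed
    have c_surj: "m \<in> c ` {..<4}" if m: "m < 4" for m
    proof (rule ccontr)
      assume nm: "m \<notin> c ` {..<4}"
      then obtain v where v: "v \<in> V" "m \<in> ?x v"
        using covered[OF m] by blast
      \<comment> \<open>If the constants miss a second value \<open>a\<close>, a column attaining
        \<open>a\<close> is taken; as they have at least two values, nothing else is missed.
        Otherwise \<open>v\<close> itself serves.\<close>
      obtain w where w: "w \<in> V" "\<forall>a<4. a \<noteq> m \<longrightarrow> a \<in> c ` {..<4} \<union> ?x w"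
      proof (cases "\<exists>a<4. a \<noteq> m \<and> a \<notin> c ` {..<4}")
        case True
        then obtain a where a: "a < 4" "a \<noteq> m" "a \<notin> c ` {..<4}" by blast
        then obtain w where w: "w \<in> V" "a \<in> ?x w"
          using covered by blast
        obtain b where b: "b < 4" "c b \<noteq> c 0"
          using nonconst by blast
        have "c 0 \<in> c ` {..<4}" "c b \<in> c ` {..<4}"
          using b by auto
        then have ne: "m \<noteq> c 0" "m \<noteq> c b" "a \<noteq> c 0" "a \<noteq> c b"
          using a nm by metis+
        have "{m, a, c 0, c b} = {..<4}"
        proof (rule card_subset_eq)
          show "card {m, a, c 0, c b} = card {..<4::nat}"
            using a(2) b(2) ne by auto
        qed (use a b m c_less in auto)
        then have "a' \<in> c ` {..<4} \<union> ?x w" if "a' < 4" "a' \<noteq> m" for a'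
          using that w b by (metis UnI1 UnI2 empty_iff imageI insert_iff lessThan_iff zero_less_numeral)
        then show ?thesis
          using that w by blast
      next
        case False
        then show ?thesis
          using that v by blast
      qed
      \<comment> \<open>The bits relative to \<open>m\<close>: only \<open>m\<close> satisfies both
        \<open>P\<close> and \<open>Q\<close>.\<close>
      define P where "P a \<longleftrightarrow> bit_P a = bit_P m" for a
      define Q where "Q a \<longleftrightarrow> bit_Q a = bit_Q m" for a
      have eq: "a = m" if "a < 4" "P a" "Q a" for a
        using bits_eq_iff[OF that(1) m] that by (simp add: P_def Q_def)
      have "\<exists>z \<in> c ` {..<4}. P z \<and> Q z"
      proof (rule gadget_two_columns[OF gadget[OF v(1)] gadget[OF w(1)] cross[OF v(1) w(1)]])
        show "P a = P b \<or> Q a = Q b" if "adj a b" for a b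
          using that by (auto simp: adj_iff P_def Q_def)
        show "\<not> (\<forall>i<4. P (c i) = P (c 0) \<and> Q (c i) = Q (c 0))"
          using nonconst c_less bits_eq_iff unfolding P_def Q_def by (metis zero_less_numeral)
        show "\<exists>z \<in> ?x v. P z \<and> Q z"
          using v(2) by (intro bexI[of _ m]) (simp_all add: P_def Q_def)
        fix p q assume "\<not> (p \<and> q)"
        moreover obtain a where "a < 4" "P a = p" "Q a = q"
          \<comment> \<open>Equality of truth values is its own inverse, so these bits yield
            \<open>P a = p\<close> and \<open>Q a = q\<close>.\<close>
          using bits_surj[of "p = bit_P m" "q = bit_Q m"] unfolding P_def Q_def by metis
        ultimately show "\<exists>z \<in> c ` {..<4} \<union> ?x w. P z = p \<and> Q z = q"
          using w(2) by (metis P_def Q_def)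
      qed
      then show False
        using eq c_less nm by auto
    qed
    have bij: "bij_betw c {..<4} {..<4}"
    proof -
      have "c ` {..<4} = {..<4}"
        using c_surj c_less by auto
      then show ?thesis
        by (simp add: bij_betw_def eq_card_imp_inj_on)
    qed
    \<comment> \<open>The cycle of edges between the constants is read off the gadget of an
      arbitrary column; the automorphism sought is \<open>c\<close> itself.\<close>
    obtain v0 where "v0 \<in> V"
      using \<open>finite V \<and> V \<noteq> {}\<close> by blast
    then have auto: "automorphism reflexive_C4 c"
      using automorphism_C4[OF bij] gadget unfolding gadget_def by blast
    have x_less: "x v i j k < 4" if "v \<in> V" "(i, j, k) \<in> triples" for v i j k
      using sA that unfolding applications_C4 x_def by (force dest: PiE_mem)
    have "\<exists>d\<in>C4_D. \<forall>(i, j, k)\<in>triples. x v i j k = c (coord d (i, j, k))" if v: "v \<in> V" for v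
    proof -
      have "\<exists>d\<in>C4_D. \<forall>(i, j, k)\<in>triples. let l = coord d (i, j, k) in
          bit_P (x v i j k) = bit_P (c l) \<and> bit_Q (x v i j k) = bit_Q (c l)"
      proof (rule gadget_one_column[OF gadget[OF v]])
        show "bit_P a = bit_P b \<or> bit_Q a = bit_Q b" if "adj a b" for a b
          using that by (simp add: adj_iff)
        show "bit_P (c i) \<noteq> bit_P (c j) \<or> bit_Q (c i) \<noteq> bit_Q (c j)"
          if "i < 4" "j < 4" "i \<noteq> j" for i j
        proof -
          have "c i \<noteq> c j"
            using bij that unfolding bij_betw_def by (metis inj_onD lessThan_iff)
          then show ?thesis
            using bits_eq_iff[OF c_less c_less] that by blast
        qed
      qed
      then obtain d where d: "d \<in> C4_D" "\<And>i j k. (i, j, k) \<in> triples \<Longrightarrow>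
          bit_P (x v i j k) = bit_P (c (coord d (i, j, k))) \<and>
          bit_Q (x v i j k) = bit_Q (c (coord d (i, j, k)))"
        unfolding Let_def by blast
      have "coord d t < 4" if "t \<in> triples" for t
        using that by (auto simp: triples_def)
      then have "x v i j k = c (coord d (i, j, k))" if "(i, j, k) \<in> triples" for i j k
        using bits_eq_iff[OF x_less[OF v that] c_less] d(2)[OF that] that by blast
      then show ?thesis
        using d(1) by blast
    qed
    then have "\<forall>v\<in>V. \<exists>d. d \<in> C4_D \<and> (\<forall>(i, j, k)\<in>triples. x v i j k = c (coord d (i, j, k)))"
      by blast
    from bchoice[OF this] obtain h where h: "\<And>v. v \<in> V \<Longrightarrow> h v \<in> C4_D"
      "\<And>v i j k. v \<in> V \<Longrightarrow> (i, j, k) \<in> triples \<Longrightarrow> x v i j k = c (coord (h v) (i, j, k))"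
      by blast
    \<comment> \<open>The column values \<open>d\<close> are glued into one assignment, restricted
      so as to be extensional on \<open>V\<close>.\<close>
    define g where "g = restrict h V"
    have "s = compose ?A c (app_map V C4_F g)"
    proof (rule extensionalityI[where A = ?A])
      fix \<alpha> assume \<alpha>: "\<alpha> \<in> ?A"
      have "s \<alpha> = c (app_value g \<alpha>)"
        using \<alpha>
      proof (cases rule: applications_C4_cases)
        case (1 b)
        then show ?thesis
          unfolding c_def by (simp only: app_value_const_app)
      next
        case (2 v i j k)
        then have "app_value g \<alpha> = coord (h v) (i, j, k)"
          using app_value_bracket_app[of g v i j k] h(1) by (simp add: g_def del: coord.simps app_value.simps)
        then show ?thesis
          using h(2)[OF 2(1,2)] 2(3) by (simp add: x_def del: coord.simps)
      qed
      then show "s \<alpha> = compose ?A c (app_map V C4_F g) \<alpha>"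
        using \<alpha> by (simp add: compose_def app_map_def)
    qed (use sA in \<open>auto simp: PiE_def compose_extensional\<close>)
    moreover have "app_map V C4_F g \<in> ?T"
      using h(1) by (auto simp: app_maps_def g_def)
    ultimately show "\<exists>\<gamma> t. automorphism reflexive_C4 \<gamma> \<and> t \<in> ?T \<and> s = compose ?A \<gamma> t"
      using auto by blast
  }
qed

end
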